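(* For every $\varepsilon>0$, the Median function does not admit a deterministic two-party communication protocol using $O\left(\log^{1-\varepsilon} n\right)$ rounds and $O(\log n)$ bits of communication in each round.
   Context: Median problem of size $n$: Alice holds a subset $A\subseteq\{1,\dots,n\}$ and Bob holds a subset $B\subseteq\{1,\dots,n\}$; they must determine the median of the multiset union of $A$ and $B$. A round of a deterministic protocol is a maximal consecutive sequence of bits sent by the same player (i.e. a single message). *)

theory Defs
  imports Complex_Main "HOL-Library.Multiset" "HOL-Library.Landau_Symbols"
begin

datatype player = Alice | Bob

text \<open>
  Deterministic two-party protocol trees: an inner node belongs to one player, who sends the bit
  computed from their own input; the protocol continues in the first subtree on bit \<^term>\<open>False\<close>
  and in the second one on bit \<^term>\<open>True\<close>.  The output at a leaf depends on the transcript only,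
  so both players know it.
\<close>

datatype ('x, 'y, 'z) protocol =
    Output 'z
  | Alice_Sends "'x \<Rightarrow> bool" "('x, 'y, 'z) protocol" "('x, 'y, 'z) protocol"
  | Bob_Sends "'y \<Rightarrow> bool" "('x, 'y, 'z) protocol" "('x, 'y, 'z) protocol"

primrec result :: "('x, 'y, 'z) protocol \<Rightarrow> 'x \<Rightarrow> 'y \<Rightarrow> 'z" where
  "result (Output z) x y = z"
| "result (Alice_Sends f P0 P1) x y = (if f x then result P1 x y else result P0 x y)"
| "result (Bob_Sends g P0 P1) x y = (if g y then result P1 x y else result P0 x y)"

primrec transcript :: "('x, 'y, 'z) protocol \<Rightarrow> 'x \<Rightarrow> 'y \<Rightarrow> (player \<times> bool) list" where
  "transcript (Output z) x y = []"
| "transcript (Alice_Sends f P0 P1) x y =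
     (Alice, f x) # (if f x then transcript P1 x y else transcript P0 x y)"
| "transcript (Bob_Sends g P0 P1) x y =
     (Bob, g y) # (if g y then transcript P1 x y else transcript P0 x y)"

function rounds :: "(player \<times> bool) list \<Rightarrow> (player \<times> bool) list list" where
  "rounds [] = []"
| "rounds (m # t) =
     (m # takeWhile (\<lambda>m'. fst m' = fst m) t) # rounds (dropWhile (\<lambda>m'. fst m' = fst m) t)"
  by pat_completeness auto
termination
  by (relation "measure length") (auto simp: le_imp_less_Suc length_dropWhile_le)

definition num_rounds :: "(player \<times> bool) list \<Rightarrow> nat" where
  "num_rounds t = length (rounds t)"

definition max_round_bits :: "(player \<times> bool) list \<Rightarrow> nat" where
  "max_round_bits t = Max (insert 0 (length ` set (rounds t)))"

text \<open>Worst-case costs over the finite nonempty sets \<open>X\<close>, \<open>Y\<close> of inputs of the two players.\<close>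

definition round_complexity :: "'x set \<Rightarrow> 'y set \<Rightarrow> ('x, 'y, 'z) protocol \<Rightarrow> nat" where
  "round_complexity X Y P = Max ((\<lambda>(x, y). num_rounds (transcript P x y)) ` (X \<times> Y))"

definition bits_per_round :: "'x set \<Rightarrow> 'y set \<Rightarrow> ('x, 'y, 'z) protocol \<Rightarrow> nat" where
  "bits_per_round X Y P = Max ((\<lambda>(x, y). max_round_bits (transcript P x y)) ` (X \<times> Y))"

text \<open>
  For a multiset of size \<open>m \<ge> 1\<close> this is the element of rank \<open>\<lceil>m / 2\<rceil>\<close> in sorted order, i.e. the
  lower of the two middle elements if \<open>m\<close> is even.  The value for the empty multiset is irrelevant.
\<close>

definition median :: "'a::linorder multiset \<Rightarrow> 'a" where
  "median M = sorted_list_of_multiset M ! ((size M - 1) div 2)"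

text \<open>
  The sum of multisets counts common elements of \<open>A\<close> and \<open>B\<close> twice.  The pair of two empty sets,
  which has no median, may be answered arbitrarily.
\<close>

definition solves_median :: "nat \<Rightarrow> (nat set, nat set, nat) protocol \<Rightarrow> bool" where
  "solves_median n P \<longleftrightarrow>
     (\<forall>A B. A \<subseteq> {1..n} \<longrightarrow> B \<subseteq> {1..n} \<longrightarrow> A \<union> B \<noteq> {} \<longrightarrow>
        result P A B = median (mset_set A + mset_set B))"

end

theory Submission
  imports Defs "HOL-Library.FuncSet" "HOL-Real_Asymp.Real_Asymp"
begin

text \<open>
  The proof is by round elimination.  An instance of level \<open>k + 1\<close> consists of \<open>m\<close> instances of
  level \<open>k\<close>: the player who speaks first holds one side of all of them, the other player holds
  an index \<open>i\<close> and the other side of the \<open>i\<close>-th one.  If the first message has \<open>b\<close> bits and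
  \<open>m\<close> is a large multiple of \<open>b\<close>, then by counting it leaves the \<open>i\<close>-th instance almost
  unrestricted for most \<open>i\<close>, so a protocol for level \<open>k\<close> with one round less remains, in which
  the other player speaks first.  To realise the construction by medians, the \<open>m\<close> instances are
  placed in consecutive blocks and the holder of \<open>i\<close> pads his set on both sides so that the
  median falls into block \<open>i\<close>.  The universe grows by a factor \<open>3 * m\<close> per level; with
  \<open>b = O(log n)\<close> this permits \<open>log n / O(log log n)\<close> levels.
\<close>

section \<open>Protocols and their costs\<close>

text \<open>Round elimination removes a message of Alice, so what remains is read with the players
  swapped; \<open>g\<close> and \<open>h\<close> let the new players simulate it from inputs of
  other types.\<close>

primrec exchange :: "('u \<Rightarrow> 'x) \<Rightarrow> ('v \<Rightarrow> 'y) \<Rightarrow> ('x, 'y, 'z) protocol \<Rightarrow> ('v, 'u, 'z) protocol" where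
  "exchange g h (Output z) = Output z"
| "exchange g h (Alice_Sends f P0 P1) = Bob_Sends (f \<circ> g) (exchange g h P0) (exchange g h P1)"
| "exchange g h (Bob_Sends f P0 P1) = Alice_Sends (f \<circ> h) (exchange g h P0) (exchange g h P1)"

primrec opponent :: "player \<Rightarrow> player" where
  "opponent Alice = Bob"
| "opponent Bob = Alice"

lemma opponent_eq_iff [simp]: "opponent p = opponent q \<longleftrightarrow> p = q"
  by (cases p; cases q) auto

lemma result_exchange: "result (exchange g h P) v u = result P (g u) (h v)"
  by (induction P) auto

lemma transcript_exchange:
  "transcript (exchange g h P) v u = map (apfst opponent) (transcript P (g u) (h v))"
  by (induction P) auto

lemma rounds_map_opponent: "rounds (map (apfst opponent) t) = map (map (apfst opponent)) (rounds t)"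
  by (induction t rule: rounds.induct) (auto simp: takeWhile_map dropWhile_map o_def)

lemma num_rounds_map_opponent: "num_rounds (map (apfst opponent) t) = num_rounds t"
  by (simp add: num_rounds_def rounds_map_opponent)

lemma max_round_bits_map_opponent:
  "max_round_bits (map (apfst opponent) t) = max_round_bits t"
  by (simp add: max_round_bits_def rounds_map_opponent image_image)

lemma max_round_bits_le_iff: "max_round_bits t \<le> b \<longleftrightarrow> (\<forall>r\<in>set (rounds t). length r \<le> b)"
  by (simp add: max_round_bits_def)

text \<open>The number of rounds when Alice has to open the conversation, possibly with an empty message.\<close>

definition cost :: "(player \<times> bool) list \<Rightarrow> nat" where
  "cost t = num_rounds t + (if t \<noteq> [] \<and> fst (hd t) = Bob then 1 else 0)"

text \<open>The change of speaker after \<open>s\<close> makes \<open>s\<close> a maximal run, so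
  splitting it off removes exactly one round and leaves the others intact.\<close>

lemma rounds_append_message:
  assumes "s \<noteq> []" "\<forall>m\<in>set s. fst m = p" "t \<noteq> [] \<longrightarrow> fst (hd t) \<noteq> p"
  shows "rounds (s @ t) = s # rounds t"
proof (cases s)
  case (Cons m s')
  have "takeWhile (\<lambda>m'. fst m' = fst m) t = []" "dropWhile (\<lambda>m'. fst m' = fst m) t = t"
    using assms Cons by (cases t; auto)+
  then show ?thesis
    using assms Cons by (simp add: takeWhile_append dropWhile_append)
qed (use assms in simp)

text \<open>Following the more popular bit costs a factor two of the inputs per bit of the message.\<close>

lemma popular_message:
  fixes P :: "('x, 'y, 'z) protocol"
  assumes "finite S"
  shows "\<exists>P' S' s. S' \<subseteq> S \<and> card S \<le> 2 ^ length s * card S' \<and> (\<forall>m\<in>set s. fst m = Alice) \<and>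
           (\<forall>x\<in>S'. \<forall>y. transcript P x y = s @ transcript P' x y \<and> result P x y = result P' x y) \<and>
           (\<forall>x y. transcript P' x y \<noteq> [] \<longrightarrow> fst (hd (transcript P' x y)) \<noteq> Alice)"
  using assms
proof (induction P arbitrary: S)
  case (Output z)
  show ?case
    by (rule exI[of _ "Output z"], rule exI[of _ S], rule exI[of _ "[]"]) auto
next
  case (Bob_Sends f P0 P1)
  \<comment> \<open>Bob is to move, so Alice's message is over and no inputs are lost.\<close>
  show ?case
    by (rule exI[of _ "Bob_Sends f P0 P1"], rule exI[of _ S], rule exI[of _ "[]"]) auto
next
  case (Alice_Sends f P0 P1)
  define V where "V = (\<lambda>c. {x\<in>S. f x = c})"
  have "S = V True \<union> V False" "V True \<inter> V False = {}" "finite (V True)" "finite (V False)"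
    using \<open>finite S\<close> by (auto simp: V_def)
  then have "card S = card (V True) + card (V False)"
    by (metis card_Un_disjoint)
  then obtain c where c: "card S \<le> 2 * card (V c)"
    by (metis add_le_mono le_cases mult_2 order_refl)
  have finV: "finite (V c)"
    using \<open>finite S\<close> by (simp add: V_def)
  define Q where "Q = (if c then P1 else P0)"
  have "\<exists>P' S' s. S' \<subseteq> V c \<and> card (V c) \<le> 2 ^ length s * card S' \<and> (\<forall>m\<in>set s. fst m = Alice) \<and>
           (\<forall>x\<in>S'. \<forall>y. transcript Q x y = s @ transcript P' x y \<and> result Q x y = result P' x y) \<and>
           (\<forall>x y. transcript P' x y \<noteq> [] \<longrightarrow> fst (hd (transcript P' x y)) \<noteq> Alice)"
    using Alice_Sends.IH(1)[OF finV] Alice_Sends.IH(2)[OF finV] by (cases c) (simp_all add: Q_def)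
  then obtain P' S' s where
    *: "S' \<subseteq> V c" "card (V c) \<le> 2 ^ length s * card S'" "\<forall>m\<in>set s. fst m = Alice"
      "\<forall>x\<in>S'. \<forall>y. transcript Q x y = s @ transcript P' x y \<and> result Q x y = result P' x y"
      "\<forall>x y. transcript P' x y \<noteq> [] \<longrightarrow> fst (hd (transcript P' x y)) \<noteq> Alice"
    by blast
  have fc: "f x = c" if "x \<in> S'" for x
    using *(1) that by (auto simp: V_def)
  have "transcript (Alice_Sends f P0 P1) x y = ((Alice, c) # s) @ transcript P' x y \<and>
      result (Alice_Sends f P0 P1) x y = result P' x y" if "x \<in> S'" for x y
    using fc[OF that] *(4) that by (cases c) (auto simp: Q_def)
  moreover have "S' \<subseteq> S"
    using *(1) by (auto simp: V_def)
  moreover have "card S \<le> 2 ^ length ((Alice, c) # s) * card S'"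
    using c *(2) by simp
  moreover have "\<forall>m\<in>set ((Alice, c) # s). fst m = Alice"
    using *(3) by simp
  ultimately show ?case
    using *(5) by blast
qed

section \<open>Round elimination\<close>

text \<open>
  The densities \<open>1/4\<close> and \<open>1/2\<close> are reproduced by round elimination, which also
  swaps the two players.  The decoder \<open>d\<close> absorbs the injective renaming of outputs caused by
  embedding an instance into a larger one.
\<close>

definition hard :: "nat \<Rightarrow> nat \<Rightarrow> 'x set \<Rightarrow> 'y set \<Rightarrow> ('x \<Rightarrow> 'y \<Rightarrow> nat) \<Rightarrow> bool" where
  "hard k b X Y F \<longleftrightarrow> (\<forall>(P :: ('x, 'y, nat) protocol) S T d.
     S \<subseteq> X \<longrightarrow> T \<subseteq> Y \<longrightarrow> card X \<le> 4 * card S \<longrightarrow> card Y \<le> 2 * card T \<longrightarrow>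
     (\<forall>x\<in>S. \<forall>y\<in>T. cost (transcript P x y) \<le> k \<and> max_round_bits (transcript P x y) \<le> b) \<longrightarrow>
     (\<exists>x\<in>S. \<exists>y\<in>T. d (result P x y) \<noteq> F x y))"

lemma hardD:
  fixes P :: "('x, 'y, nat) protocol" and d :: "nat \<Rightarrow> nat"
  assumes "hard k b X Y F" "S \<subseteq> X" "T \<subseteq> Y" "card X \<le> 4 * card S" "card Y \<le> 2 * card T"
    and "\<And>x y. x \<in> S \<Longrightarrow> y \<in> T \<Longrightarrow> cost (transcript P x y) \<le> k"
    and "\<And>x y. x \<in> S \<Longrightarrow> y \<in> T \<Longrightarrow> max_round_bits (transcript P x y) \<le> b"
  obtains x y where "x \<in> S" "y \<in> T" "d (result P x y) \<noteq> F x y"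
proof -
  have "\<exists>x\<in>S. \<exists>y\<in>T. d (result P x y) \<noteq> F x y"
    by (rule assms(1)[unfolded hard_def, rule_format]) (use assms in auto)
  then show thesis
    using that by blast
qed

text \<open>An empty or infinite set has \<open>card\<close> 0, so \<open>{}\<close> would count as
  dense in it, and no protocol errs on \<open>{}\<close>.\<close>

lemma hard_imp_finite_nonempty:
  assumes "hard k b X Y F"
  shows "finite X" "X \<noteq> {}" "finite Y" "Y \<noteq> {}"
proof -
  have "card X \<noteq> 0"
  proof
    assume "card X = 0"
    then show False
      using assms[unfolded hard_def, THEN spec, of "Output 0", THEN spec, of "{}", THEN spec, of Y]
      by simp
  qed
  moreover have "card Y \<noteq> 0"
  proof
    assume "card Y = 0"
    then show False
      using assms[unfolded hard_def, THEN spec, of "Output 0", THEN spec, of X, THEN spec, of "{}"]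
      by simp
  qed
  ultimately show "finite X" "X \<noteq> {}" "finite Y" "Y \<noteq> {}"
    by (auto intro: card_ge_0_finite)
qed

section \<open>Counting: a coordinate about which little is known\<close>

text \<open>\<open>S\<close> is contained in the box spanned by its projections.\<close>

lemma card_le_prod_projections:
  assumes "finite X" "finite I" "S \<subseteq> I \<rightarrow>\<^sub>E X"
  shows "card S \<le> (\<Prod>i\<in>I. card ((\<lambda>f. f i) ` S))"
proof -
  have "finite S"
    using assms finite_PiE[of I "\<lambda>_. X"] finite_subset by blast
  have "S \<subseteq> (\<Pi>\<^sub>E i\<in>I. (\<lambda>f. f i) ` S)"
    using assms(3) by (intro subsetI PiE_I) (auto dest: PiE_arb)
  then have "card S \<le> card (\<Pi>\<^sub>E i\<in>I. (\<lambda>f. f i) ` S)"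
    using \<open>finite S\<close> assms(2) by (intro card_mono finite_PiE) auto
  then show ?thesis
    using assms(2) by (simp add: card_PiE)
qed

text \<open>By averaging, at least \<open>b + 3\<close> slices of \<open>T\<close> have density
  \<open>1/4\<close>. If \<open>S\<close> had projections of density below \<open>1/2\<close> at all
  of them, its own density would be at most \<open>2 ^ -(b + 3)\<close>, but it is at least
  \<open>2 ^ -(b + 2)\<close>.\<close>

lemma dense_coordinate:
  assumes "finite X" "X \<noteq> {}" "finite Y" "Y \<noteq> {}" and m: "m = 4 * (b + 3)"
    and S: "S \<subseteq> {..<m} \<rightarrow>\<^sub>E X" "card X ^ m \<le> 2 ^ (b + 2) * card S"
    and T: "T \<subseteq> {..<m} \<times> Y" "m * card Y \<le> 2 * card T"
  obtains i where "i < m" "card X \<le> 2 * card ((\<lambda>f. f i) ` S)" "card Y \<le> 4 * card {y. (i, y) \<in> T}"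
proof -
  define G where "G = {i. i < m \<and> card Y \<le> 4 * card {y. (i, y) \<in> T}}"
  have G: "finite G" "G \<subseteq> {..<m}"
    by (auto simp: G_def)
  have X0: "card X > 0" and Y0: "card Y > 0"
    using assms(1-4) by (simp_all add: card_gt_0_iff)
  have slice: "{y. (i, y) \<in> T} \<subseteq> Y" for i
    using T(1) by auto
  have "card T = card (SIGMA i:{..<m}. {y. (i, y) \<in> T})"
    using T(1) by (intro arg_cong[of _ _ card]) auto
  also have "\<dots> = (\<Sum>i<m. card {y. (i, y) \<in> T})"
    using finite_subset[OF slice \<open>finite Y\<close>] by (intro card_SigmaI) auto
  finally have "card T = (\<Sum>i<m. card {y. (i, y) \<in> T})" .
  then have "4 * card T = (\<Sum>i<m. 4 * card {y. (i, y) \<in> T})"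
    by (simp add: sum_distrib_left)
  \<comment> \<open>A slice outside \<open>G\<close> contributes at most \<open>card Y\<close>, any
    other at most \<open>4 * card Y\<close>.\<close>
  also have "\<dots> \<le> (\<Sum>i<m. card Y + (if i \<in> G then 3 * card Y else 0))"
  proof (rule sum_mono)
    fix i assume "i \<in> {..<m}"
    moreover have "card {y. (i, y) \<in> T} \<le> card Y"
      by (intro card_mono slice \<open>finite Y\<close>)
    ultimately show "4 * card {y. (i, y) \<in> T} \<le> card Y + (if i \<in> G then 3 * card Y else 0)"
      by (auto simp: G_def)
  qed
  also have "\<dots> = m * card Y + card G * (3 * card Y)"
    using G(2) by (simp add: sum.distrib sum.If_cases Int_absorb1)
  also have "card G * (3 * card Y) = (3 * card G) * card Y"
    by simp
  finally have "m * card Y \<le> (3 * card G) * card Y"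
    using T(2) by linarith
  then have "m \<le> 3 * card G"
    using Y0 by simp
  then have cG: "b + 3 \<le> card G"
    using m by simp
  have "\<exists>i\<in>G. card X \<le> 2 * card ((\<lambda>f. f i) ` S)"
  proof (rule ccontr)
    assume "\<not> ?thesis"
    then have sparse: "2 * card ((\<lambda>f. f i) ` S) \<le> card X" if "i \<in> G" for i
      using that by auto
    have proj: "card ((\<lambda>f. f i) ` S) \<le> card X" if "i < m" for i
      using S(1) that by (intro card_mono \<open>finite X\<close>) auto
    \<comment> \<open>The factors 2 are charged to the coordinates in \<open>G\<close>, where a
      projection has at most half the size of \<open>X\<close>.\<close>
    have "2 ^ card G * card S \<le> (\<Prod>i<m. if i \<in> G then 2 else 1) * (\<Prod>i<m. card ((\<lambda>f. f i) ` S))"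
      using card_le_prod_projections[OF \<open>finite X\<close> _ S(1)] G(2)
      by (simp add: prod.If_cases Int_absorb1)
    also have "\<dots> = (\<Prod>i<m. (if i \<in> G then 2 else 1) * card ((\<lambda>f. f i) ` S))"
      by (simp add: prod.distrib)
    also have "\<dots> \<le> (\<Prod>i<m. card X)"
      using sparse proj by (intro prod_mono) auto
    also have "\<dots> \<le> 2 ^ (b + 2) * card S"
      using S(2) by simp
    finally have "2 ^ card G * card S \<le> 2 ^ (b + 2) * card S" .
    moreover have "card S > 0"
      using S(2) X0 by (cases "card S = 0") auto
    ultimately have "(2::nat) ^ card G \<le> 2 ^ (b + 2)"
      by simp
    then have "card G \<le> b + 2"
      by (subst (asm) power_increasing_iff) auto
    then show False
      using cG by simp
  qed
  then show thesis
    using that by (auto simp: G_def)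
qed

text \<open>
  A message of \<open>b\<close> bits about \<open>m\<close> independent inputs with \<open>m\<close> much larger than \<open>b\<close> is
  almost useless for the one input selected by the receiver.
\<close>

lemma hard_Suc:
  fixes enc :: "(nat \<Rightarrow> 'u) \<Rightarrow> 'x" and enc' :: "nat \<times> 'v \<Rightarrow> 'y"
  assumes hard: "hard k b V U (\<lambda>v u. F u v)" and m: "m = 4 * (b + 3)"
    and inj: "inj_on enc ({..<m} \<rightarrow>\<^sub>E U)" "inj_on enc' ({..<m} \<times> V)"
    and G: "\<And>f i v. f \<in> {..<m} \<rightarrow>\<^sub>E U \<Longrightarrow> i < m \<Longrightarrow> v \<in> V \<Longrightarrow> h i (G (enc f) (enc' (i, v))) = F (f i) v"
  shows "hard (Suc k) b (enc ` ({..<m} \<rightarrow>\<^sub>E U)) (enc' ` ({..<m} \<times> V)) G"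
  unfolding hard_def
proof (intro allI impI)
  fix P :: "('x, 'y, nat) protocol" and S T and d :: "nat \<Rightarrow> nat"
  assume S: "S \<subseteq> enc ` ({..<m} \<rightarrow>\<^sub>E U)" "card (enc ` ({..<m} \<rightarrow>\<^sub>E U)) \<le> 4 * card S"
    and T: "T \<subseteq> enc' ` ({..<m} \<times> V)" "card (enc' ` ({..<m} \<times> V)) \<le> 2 * card T"
    and bounds: "\<forall>x\<in>S. \<forall>y\<in>T. cost (transcript P x y) \<le> Suc k \<and> max_round_bits (transcript P x y) \<le> b"
  note fin = hard_imp_finite_nonempty[OF hard]
  have finE: "finite ({..<m} \<rightarrow>\<^sub>E U)"
    using fin by (intro finite_PiE) auto
  then have "finite S"
    using S(1) finite_surj by blast
  show "\<exists>x\<in>S. \<exists>y\<in>T. d (result P x y) \<noteq> G x y"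
  proof (rule ccontr)
    assume "\<not> ?thesis"
    then have correct: "\<And>x y. x \<in> S \<Longrightarrow> y \<in> T \<Longrightarrow> d (result P x y) = G x y"
      by blast
    obtain P' S' s where S': "S' \<subseteq> S" "card S \<le> 2 ^ length s * card S'"
      and s: "\<forall>m\<in>set s. fst m = Alice"
      and run: "\<And>x y. x \<in> S' \<Longrightarrow> transcript P x y = s @ transcript P' x y"
        "\<And>x y. x \<in> S' \<Longrightarrow> result P x y = result P' x y"
      and P': "\<And>x y. transcript P' x y \<noteq> [] \<longrightarrow> fst (hd (transcript P' x y)) \<noteq> Alice"
      using popular_message[OF \<open>finite S\<close>, of P] by blast
    have cS: "card U ^ m \<le> 4 * card S"
      using S(2) by (simp add: card_image[OF inj(1)] card_PiE)
    have cT: "m * card V \<le> 2 * card T"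
      using T(2) by (simp add: card_image[OF inj(2)] card_cartesian_product)
    have "card U > 0" "card V > 0" "m > 0"
      using fin m by (simp_all add: card_gt_0_iff)
    then have "card U ^ m > 0" "m * card V > 0"
      by simp_all
    then have "card S \<noteq> 0" "card T \<noteq> 0"
      using cS cT by linarith+
    then have "S' \<noteq> {}" "T \<noteq> {}"
      using S'(2) by auto
    \<comment> \<open>Nonempty \<open>S'\<close> and \<open>T\<close> provide an actual run within
      the budget, in which \<open>s\<close> is one complete round.\<close>
    have len: "length s \<le> b"
    proof (cases "s = []")
      case False
      obtain x y where xy: "x \<in> S'" "y \<in> T"
        using \<open>S' \<noteq> {}\<close> \<open>T \<noteq> {}\<close> by blast
      then have "s \<in> set (rounds (transcript P x y))"
        using rounds_append_message[OF False s P'] by (simp add: run)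
      moreover have "max_round_bits (transcript P x y) \<le> b"
        using bounds xy S'(1) by blast
      ultimately show ?thesis
        by (simp add: max_round_bits_le_iff)
    qed simp
    \<comment> \<open>If \<open>s\<close> is empty, no round is removed; but then a nonempty
      transcript opens with Bob, and the surcharge in \<open>cost\<close> makes up for it.\<close>
    have after: "num_rounds (transcript P' x y) \<le> k" "max_round_bits (transcript P' x y) \<le> b"
      if "x \<in> S'" "y \<in> T" for x y
    proof -
      have *: "cost (s @ transcript P' x y) \<le> Suc k" "max_round_bits (s @ transcript P' x y) \<le> b"
        using bounds[rule_format, of x y] that S'(1) unfolding run(1)[OF that(1)] by blast+
      have "rounds (s @ transcript P' x y) = (if s = [] then [] else [s]) @ rounds (transcript P' x y)"
        using rounds_append_message[OF _ s P'] by simp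
      moreover have "transcript P' x y \<noteq> [] \<Longrightarrow> fst (hd (transcript P' x y)) = Bob"
        using P'[of x y] player.exhaust[of "fst (hd (transcript P' x y))"] by blast
      ultimately show "num_rounds (transcript P' x y) \<le> k" "max_round_bits (transcript P' x y) \<le> b"
        using * by (cases "transcript P' x y = []";
            auto simp: max_round_bits_le_iff cost_def num_rounds_def split: if_splits)+
    qed
    define S0 where "S0 = {f \<in> {..<m} \<rightarrow>\<^sub>E U. enc f \<in> S'}"
    define T0 where "T0 = {p \<in> {..<m} \<times> V. enc' p \<in> T}"
    have S0: "S0 \<subseteq> {..<m} \<rightarrow>\<^sub>E U" and T0: "T0 \<subseteq> {..<m} \<times> V"
      by (auto simp: S0_def T0_def)
    have "S' = enc ` S0"
      using S(1) S'(1) unfolding S0_def by blast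
    moreover have "T = enc' ` T0"
      using T(1) unfolding T0_def by blast
    ultimately have c0: "card S' = card S0" "card T = card T0"
      using card_image[OF inj_on_subset[OF inj(1) S0]] card_image[OF inj_on_subset[OF inj(2) T0]]
      by simp_all
    \<comment> \<open>In the exponent \<open>b + 2\<close>, the message accounts for
      \<open>b\<close> and the initial density \<open>1/4\<close> for 2.\<close>
    have "card U ^ m \<le> 4 * (2 ^ length s * card S')"
      using cS S'(2) by linarith
    also have "\<dots> \<le> 4 * (2 ^ b * card S')"
      using len by (intro mult_le_mono power_increasing) auto
    finally have dS: "card U ^ m \<le> 2 ^ (b + 2) * card S0"
      using c0 by simp
    obtain i where i: "i < m" "card U \<le> 2 * card ((\<lambda>f. f i) ` S0)" "card V \<le> 4 * card {v. (i, v) \<in> T0}"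
      using dense_coordinate[OF fin(3,4,1,2) m S0 dS T0] cT unfolding c0 by blast
    \<comment> \<open>The holder of \<open>u\<close> fills in the other coordinates himself; any
      completion in \<open>S0\<close> will do, as correctness and cost bounds hold on all of
      \<open>S'\<close> and \<open>T\<close>.\<close>
    define g where "g = (\<lambda>u. SOME f. f \<in> S0 \<and> f i = u)"
    have g: "g u \<in> S0" "g u i = u" if "u \<in> (\<lambda>f. f i) ` S0" for u
      using someI_ex[of "\<lambda>f. f \<in> S0 \<and> f i = u"] that by (auto simp: g_def)
    define Q where "Q = exchange (enc \<circ> g) (\<lambda>v. enc' (i, v)) P'"
    obtain v u where vu: "v \<in> {v. (i, v) \<in> T0}" "u \<in> (\<lambda>f. f i) ` S0"
      "(h i \<circ> d) (result Q v u) \<noteq> F u v"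
    proof (rule hardD[OF hard, where S="{v. (i, v) \<in> T0}" and T="(\<lambda>f. f i) ` S0" and P=Q and d="h i \<circ> d"])
      fix v u assume vu: "v \<in> {v. (i, v) \<in> T0}" "u \<in> (\<lambda>f. f i) ` S0"
      then have in': "enc (g u) \<in> S'" "enc' (i, v) \<in> T"
        using g(1)[OF vu(2)] by (auto simp: S0_def T0_def)
      \<comment> \<open>After the swap every nonempty transcript opens with Alice, so there is no
        surcharge.\<close>
      have "cost (map (apfst opponent) t) = num_rounds t" if "t \<noteq> [] \<longrightarrow> fst (hd t) \<noteq> Alice" for t
        using that by (auto simp: cost_def num_rounds_map_opponent hd_map) (metis opponent.simps player.exhaust)
      then show "cost (transcript Q v u) \<le> k" "max_round_bits (transcript Q v u) \<le> b"
        using after[OF in'] P' by (auto simp: Q_def transcript_exchange max_round_bits_map_opponent)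
    qed (use i in \<open>auto simp: S0_def T0_def\<close>)
    have in': "g u \<in> {..<m} \<rightarrow>\<^sub>E U" "enc (g u) \<in> S'" "v \<in> V" "enc' (i, v) \<in> T"
      using g(1)[OF vu(2)] vu(1) by (auto simp: S0_def T0_def)
    have "d (result Q v u) = G (enc (g u)) (enc' (i, v))"
      using correct[of "enc (g u)" "enc' (i, v)"] run(2)[OF in'(2)] in' S'(1)
      by (auto simp: Q_def result_exchange)
    then show False
      using vu(3) G[OF in'(1) i(1) in'(3)] g(2)[OF vu(2)] by simp
  qed
qed

section \<open>Hard instances of the median problem\<close>

text \<open>In sorted order the three multisets are consecutive, and \<open>2 * size L\<close>
  further elements move the middle index by \<open>size L\<close>. A nonempty \<open>I\<close> keeps
  the truncated subtraction exact and links \<open>L\<close> to \<open>R\<close> by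
  transitivity.\<close>

lemma median_padding:
  fixes L I R :: "'a::linorder multiset"
  assumes "\<And>x y. x \<in># L \<Longrightarrow> y \<in># I \<Longrightarrow> x \<le> y" "\<And>x y. x \<in># I \<Longrightarrow> y \<in># R \<Longrightarrow> x \<le> y"
    and "size L = size R" "I \<noteq> {#}"
  shows "median (L + I + R) = median I"
proof -
  define l where "l = sorted_list_of_multiset L"
  define c where "c = sorted_list_of_multiset I"
  define r where "r = sorted_list_of_multiset R"
  have mset: "mset l = L" "mset c = I" "mset r = R"
    by (simp_all add: l_def c_def r_def)
  have len: "length l = size L" "length c = size I" "length r = size R"
    by (simp_all flip: mset)
  have "x \<le> y" if xy: "x \<in># L" "y \<in># R" for x y
  proof -
    obtain z where "z \<in># I"
      using assms(4) by blast
    then show ?thesis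
      using assms(1)[OF xy(1)] assms(2)[OF _ xy(2)] order_trans by blast
  qed
  then have "sorted (l @ c @ r)"
    using assms(1,2) by (auto simp: sorted_append l_def c_def r_def)
  moreover have "mset (l @ c @ r) = L + I + R"
    by (simp add: mset)
  ultimately have "sorted_list_of_multiset (L + I + R) = l @ c @ r"
    by (metis sorted_list_of_multiset_mset sorted_sort_id)
  moreover have "size I > 0"
    using assms(4) by (simp add: nonempty_has_size)
  then have "(size (L + I + R) - 1) div 2 = size L + (size I - 1) div 2" "(size I - 1) div 2 < size I"
    using assms(3) by auto
  ultimately show ?thesis
    by (simp add: median_def nth_append len flip: c_def)
qed

lemma median_image_add:
  fixes M :: "nat multiset"
  assumes "M \<noteq> {#}"
  shows "median (image_mset ((+) c) M) = c + median M"
proof -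
  define l where "l = sorted_list_of_multiset M"
  have "sorted (map ((+) c) l)"
    by (simp add: sorted_map l_def sorted_wrt_map)
  moreover have "mset (map ((+) c) l) = image_mset ((+) c) M"
    by (simp add: l_def)
  ultimately have "sorted_list_of_multiset (image_mset ((+) c) M) = map ((+) c) l"
    by (metis sorted_list_of_multiset_mset sorted_sort_id)
  moreover have "size M > 0"
    using assms by (simp add: nonempty_has_size)
  then have "(size M - 1) div 2 < length l"
    by (simp add: l_def flip: size_mset)
  ultimately show ?thesis
    by (simp add: median_def flip: l_def)
qed

section \<open>Embedding \<open>m\<close> instances into one by blocks and margins\<close>

context
  fixes m N :: nat
begin

text \<open>
  The universe consists of a left margin and a right margin, each of width \<open>m * N\<close>, and of \<open>m\<close>
  blocks of width \<open>N\<close> in between.  Block \<open>j\<close> starts after \<open>offset j\<close>.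
\<close>

definition offset :: "nat \<Rightarrow> nat" where
  "offset j = m * N + j * N"

definition blocks :: "(nat \<Rightarrow> nat set) \<Rightarrow> nat set" where
  "blocks f = (\<Union>j<m. (+) (offset j) ` f j)"

text \<open>
  If all sets of the other player have size \<open>s\<close>, the margins of \<open>select s (i, B)\<close> bring the number
  of elements on either side of block \<open>i\<close> to \<open>(m - 1) * s\<close>.
\<close>

definition select :: "nat \<Rightarrow> nat \<times> nat set \<Rightarrow> nat set" where
  "select s = (\<lambda>(i, B).
     {1..(m - 1 - i) * s} \<union> (+) (offset i) ` B \<union> (+) (2 * m * N) ` {1..i * s})"

lemma offset_mono: "i < j \<Longrightarrow> offset i + N \<le> offset j"
  using mult_le_mono1[of "Suc i" j N] by (simp add: offset_def)

lemma offset_bounds: "m * N \<le> offset i" "i < m \<Longrightarrow> offset i + N \<le> 2 * m * N"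
  using mult_le_mono1[of "Suc i" m N] by (simp_all add: offset_def mult_2 add_mult_distrib)

text \<open>Different offsets are at least \<open>N\<close> apart, while positions within a block
  differ by less than \<open>N\<close>.\<close>

lemma offset_unique:
  assumes "offset i + x = offset j + y" "x \<in> {1..N}" "y \<in> {1..N}"
  shows "i = j" "x = y"
proof -
  show "i = j"
    using assms offset_mono[of i j] offset_mono[of j i] by (cases i j rule: linorder_cases) auto
  then show "x = y"
    using assms(1) by simp
qed

lemma offset_disjoint:
  assumes "A \<subseteq> {1..N}" "B \<subseteq> {1..N}" "i \<noteq> j"
  shows "(+) (offset i) ` A \<inter> (+) (offset j) ` B = {}"
proof (rule equals0I)
  fix z assume "z \<in> (+) (offset i) ` A \<inter> (+) (offset j) ` B"
  then obtain x y where "offset i + x = offset j + y" "x \<in> A" "y \<in> B"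
    by auto
  then show False
    using offset_unique(1) assms by blast
qed

text \<open>Each coordinate is recovered from its own block. Injectivity allows densities to be
  counted on tuples instead of encoded sets.\<close>

lemma inj_on_blocks:
  assumes "U \<subseteq> Pow {1..N}"
  shows "inj_on blocks ({..<m} \<rightarrow>\<^sub>E U)"
proof (rule inj_onI)
  have block: "f j = {x \<in> {1..N}. offset j + x \<in> blocks f}" if f: "f \<in> {..<m} \<rightarrow>\<^sub>E U" and "j < m" for f j
  proof -
    have sub: "f j' \<subseteq> {1..N}" if "j' < m" for j'
      using PiE_mem[OF f] that assms by auto
    show ?thesis
    proof (intro equalityI subsetI)
      fix x assume "x \<in> f j"
      then show "x \<in> {x \<in> {1..N}. offset j + x \<in> blocks f}"
        using sub[OF \<open>j < m\<close>] \<open>j < m\<close> unfolding blocks_def by blast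
    next
      fix x assume "x \<in> {x \<in> {1..N}. offset j + x \<in> blocks f}"
      then obtain j' y where "x \<in> {1..N}" "offset j + x = offset j' + y" "j' < m" "y \<in> f j'"
        unfolding blocks_def by auto
      then show "x \<in> f j"
        using offset_unique[of j x j' y] sub by blast
    qed
  qed
  fix f g assume fg: "f \<in> {..<m} \<rightarrow>\<^sub>E U" "g \<in> {..<m} \<rightarrow>\<^sub>E U" "blocks f = blocks g"
  show "f = g"
  proof (rule PiE_ext[OF fg(1,2)])
    fix j assume "j \<in> {..<m}"
    then show "f j = g j"
      using block[OF fg(1)] block[OF fg(2)] fg(3) by simp
  qed
qed

text \<open>The padding fits because a margin of width \<open>m * N\<close> has room for
  \<open>m\<close> portions of size \<open>s\<close>.\<close>

lemma select_parts:
  assumes "B \<subseteq> {1..N}" "i < m" "s \<le> N"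
  shows "{1..(m - 1 - i) * s} \<subseteq> {1..m * N}" "(+) (offset i) ` B \<subseteq> {m * N + 1..2 * m * N}"
    "(+) (2 * m * N) ` {1..i * s} \<subseteq> {2 * m * N + 1..3 * m * N}"
proof -
  have "(m - 1 - i) * s \<le> m * N" "i * s \<le> m * N" "i * s \<le> N * m"
    using assms mult_le_mono[of i m s N] by (auto intro: mult_le_mono simp: mult.commute)
  then show "{1..(m - 1 - i) * s} \<subseteq> {1..m * N}"
    "(+) (2 * m * N) ` {1..i * s} \<subseteq> {2 * m * N + 1..3 * m * N}"
    by auto
  show "(+) (offset i) ` B \<subseteq> {m * N + 1..2 * m * N}"
    using assms(1) offset_bounds(1)[of i] offset_bounds(2)[OF assms(2)] by fastforce
qed

lemma mset_set_select:
  assumes "B \<subseteq> {1..N}" "i < m" "s \<le> N"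
  shows "mset_set (select s (i, B)) = mset_set {1..(m - 1 - i) * s} +
    image_mset ((+) (offset i)) (mset_set B) + mset_set ((+) (2 * m * N) ` {1..i * s})"
proof -
  note parts = select_parts[OF assms]
  have "finite B"
    using assms(1) finite_subset by blast
  have d: "{1..m * N} \<inter> {m * N + 1..2 * m * N} = {}" "{1..m * N} \<inter> {2 * m * N + 1..3 * m * N} = {}"
    "{m * N + 1..2 * m * N} \<inter> {2 * m * N + 1..3 * m * N} = {}"
    by auto
  have "{1..(m - 1 - i) * s} \<inter> (+) (offset i) ` B = {}"
    using Int_mono[OF parts(1,2)] unfolding d by blast
  moreover have "({1..(m - 1 - i) * s} \<union> (+) (offset i) ` B) \<inter> (+) (2 * m * N) ` {1..i * s} = {}"
    using Int_mono[OF parts(1,3)] Int_mono[OF parts(2,3)] unfolding d Int_Un_distrib2 by blast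
  ultimately show ?thesis
    using \<open>finite B\<close> by (simp add: select_def mset_set_Union image_mset_mset_set)
qed

lemma mset_set_blocks:
  assumes "\<And>j. j < m \<Longrightarrow> f j \<subseteq> {1..N}"
  shows "mset_set (blocks f) = (\<Sum>j<m. image_mset ((+) (offset j)) (mset_set (f j)))"
proof -
  have "mset_set (\<Union>j<k. (+) (offset j) ` f j) = (\<Sum>j<k. image_mset ((+) (offset j)) (mset_set (f j)))"
    if "k \<le> m" for k
    using that
  proof (induction k)
    case (Suc k)
    have fin: "finite (f j)" if "j < m" for j
      using assms[OF that] finite_subset by blast
    have "(\<Union>j<k. (+) (offset j) ` f j) \<inter> (+) (offset k) ` f k = {}"
    proof -
      have "(+) (offset j) ` f j \<inter> (+) (offset k) ` f k = {}" if "j < k" for j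
        using that Suc.prems by (intro offset_disjoint assms) auto
      then show ?thesis
        by blast
    qed
    then have "mset_set (\<Union>j<Suc k. (+) (offset j) ` f j) =
        mset_set (\<Union>j<k. (+) (offset j) ` f j) + mset_set ((+) (offset k) ` f k)"
      using fin Suc.prems by (subst mset_set_Union[symmetric]) (auto simp: lessThan_Suc Un_commute)
    then show ?case
      using Suc by (simp add: image_mset_mset_set)
  qed simp
  then show ?thesis
    by (simp add: blocks_def)
qed

text \<open>The padding of the next level relies on a common size, so the size of an encoded set
  must not depend on the instance.\<close>

lemma card_blocks:
  assumes "\<And>j. j < m \<Longrightarrow> f j \<subseteq> {1..N} \<and> card (f j) = s"
  shows "card (blocks f) = m * s"
proof -
  have "card (blocks f) = size (mset_set (blocks f))"
    by simp
  also have "\<dots> = (\<Sum>j<m. card (f j))"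
    by (subst mset_set_blocks) (use assms in auto)
  finally show ?thesis
    using assms by simp
qed

text \<open>The two margins together always receive \<open>m - 1\<close> portions of size
  \<open>s\<close>, so \<open>i\<close> drops out.\<close>

lemma card_select:
  assumes "B \<subseteq> {1..N}" "i < m" "s \<le> N"
  shows "card (select s (i, B)) = (m - 1) * s + card B"
proof -
  have "card (select s (i, B)) = size (mset_set (select s (i, B)))"
    by simp
  also have "\<dots> = (m - 1 - i) * s + card B + i * s"
    by (subst mset_set_select[OF assms]) (simp add: card_image)
  also have "\<dots> = (m - 1 - i + i) * s + card B"
    by (simp only: add_mult_distrib)
  finally show ?thesis
    using assms(2) by simp
qed

lemma blocks_subset:
  assumes "\<And>j. j < m \<Longrightarrow> f j \<subseteq> {1..N}"
  shows "blocks f \<subseteq> {1..3 * m * N}"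
  unfolding blocks_def
proof (rule UN_least)
  fix j assume "j \<in> {..<m}"
  then have "(+) (offset j) ` f j \<subseteq> {m * N + 1..2 * m * N}"
    by (intro select_parts(2)[OF assms _ le0]) auto
  also have "\<dots> \<subseteq> {1..3 * m * N}"
    by auto
  finally show "(+) (offset j) ` f j \<subseteq> {1..3 * m * N}" .
qed

lemma select_subset:
  assumes "B \<subseteq> {1..N}" "i < m" "s \<le> N"
  shows "select s (i, B) \<subseteq> {1..3 * m * N}"
  using select_parts[OF assms] by (auto simp: select_def subset_iff)

text \<open>Between the margins lies exactly the shifted \<open>B\<close>, and any of its elements
  reveals \<open>i\<close>; this is where \<open>{} \<notin> V\<close> enters.\<close>

lemma inj_on_select:
  assumes "V \<subseteq> Pow {1..N}" "{} \<notin> V" "s \<le> N"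
  shows "inj_on (select s) ({..<m} \<times> V)"
proof (rule inj_onI)
  have middle: "select s (i, B) \<inter> {m * N + 1..2 * m * N} = (+) (offset i) ` B" if "i < m" "B \<in> V" for i B
  proof -
    have "B \<subseteq> {1..N}"
      using assms(1) that by blast
    note parts = select_parts[OF this that(1) assms(3)]
    have "{1..m * N} \<inter> {m * N + 1..2 * m * N} = {}"
      "{2 * m * N + 1..3 * m * N} \<inter> {m * N + 1..2 * m * N} = {}"
      by auto
    then show ?thesis
      using parts unfolding select_def by blast
  qed
  fix p q assume pq: "p \<in> {..<m} \<times> V" "q \<in> {..<m} \<times> V" "select s p = select s q"
  obtain i B j C where [simp]: "p = (i, B)" "q = (j, C)"
    by (cases p, cases q)
  have *: "i \<in> {..<m}" "B \<in> V" "j \<in> {..<m}" "C \<in> V" "select s (i, B) = select s (j, C)"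
    using pq by auto
  have eq: "(+) (offset i) ` B = (+) (offset j) ` C"
    using middle[of i B] middle[of j C] * by simp
  obtain x where "x \<in> B"
    using * assms(2) by (metis all_not_in_conv)
  then obtain y where "y \<in> C" "offset i + x = offset j + y"
    using eq by blast
  then have "i = j"
    using offset_unique(1)[of i x j y] \<open>x \<in> B\<close> * assms(1) by blast
  then show "p = q"
    using eq by (simp add: inj_image_eq_iff)
qed

text \<open>Either side of block \<open>i\<close> receives \<open>m - 1\<close> portions of size
  \<open>s\<close>, from blocks or from padding, so \<open>median_padding\<close> discards both
  sides.\<close>

lemma median_blocks_select:
  assumes f: "\<And>j. j < m \<Longrightarrow> f j \<subseteq> {1..N}" "\<And>j. j < m \<Longrightarrow> card (f j) = s"
    and "i < m" and B: "B \<subseteq> {1..N}" "B \<noteq> {}"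
  shows "median (mset_set (blocks f) + mset_set (select s (i, B))) =
    offset i + median (mset_set (f i) + mset_set B)"
proof -
  define blk where "blk = (\<lambda>j. image_mset ((+) (offset j)) (mset_set (f j)))"
  define L where "L = (\<Sum>j<i. blk j) + mset_set {1..(m - 1 - i) * s}"
  define I where "I = image_mset ((+) (offset i)) (mset_set (f i) + mset_set B)"
  define R where "R = (\<Sum>j\<in>{i<..<m}. blk j) + mset_set ((+) (2 * m * N) ` {1..i * s})"
  have "s \<le> N"
    using f[OF \<open>i < m\<close>] card_mono[of "{1..N}" "f i"] by simp
  note parts = select_parts[OF B(1) \<open>i < m\<close> this]
  have finB: "finite B"
    using B(1) finite_subset by blast
  have blk: "x \<in> {offset j + 1..offset j + N}" if "x \<in># blk j" "j < m" for x j
  proof -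
    have "x \<in> (+) (offset j) ` f j"
      using that by (cases "finite (f j)") (auto simp: blk_def)
    then show ?thesis
      using f(1)[OF that(2)] by fastforce
  qed
  have I: "x \<in> {offset i + 1..offset i + N}" if "x \<in># I" for x
  proof -
    have "x \<in> (+) (offset i) ` (f i \<union> B)"
      using that finB by (cases "finite (f i)") (auto simp: I_def)
    then show ?thesis
      using f(1)[OF \<open>i < m\<close>] B(1) by fastforce
  qed
  have ob: "m * N \<le> offset i" "offset i + N \<le> 2 * m * N"
    using offset_bounds \<open>i < m\<close> by auto
  have L: "x \<le> offset i" if "x \<in># L" for x
  proof -
    have "(\<exists>j<i. x \<in># blk j) \<or> x \<in> {1..(m - 1 - i) * s}"
      using that by (auto simp: L_def set_mset_sum)
    then show ?thesis
    proof
      assume "\<exists>j<i. x \<in># blk j"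
      then obtain j where "j < i" "x \<in># blk j"
        by blast
      then show ?thesis
        using blk[of x j] offset_mono[of j i] \<open>i < m\<close> by simp
    next
      assume "x \<in> {1..(m - 1 - i) * s}"
      then have "x \<in> {1..m * N}"
        using parts(1) by blast
      then show ?thesis
        using ob(1) by simp
    qed
  qed
  have R: "offset i + N \<le> x" if "x \<in># R" for x
  proof -
    have "(\<exists>j\<in>{i<..<m}. x \<in># blk j) \<or> x \<in> (+) (2 * m * N) ` {1..i * s}"
      using that by (auto simp: R_def set_mset_sum)
    then show ?thesis
    proof
      assume "\<exists>j\<in>{i<..<m}. x \<in># blk j"
      then obtain j where "i < j" "j < m" "x \<in># blk j"
        by auto
      then show ?thesis
        using blk[of x j] offset_mono[of i j] by simp
    next
      assume "x \<in> (+) (2 * m * N) ` {1..i * s}"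
      then show ?thesis
        using ob(2) by auto
    qed
  qed
  have size_blk: "size (blk j) = s" if "j < m" for j
    using f(2)[OF that] by (simp add: blk_def)
  have size: "size L = size R"
    using \<open>i < m\<close> by (simp add: L_def R_def size_blk card_image)
  have ne: "mset_set (f i) + mset_set B \<noteq> {#}"
    using B(2) finB by (simp add: mset_set_empty_iff)
  have "(\<Sum>j<m. blk j) = (\<Sum>j\<in>insert i ({..<i} \<union> {i<..<m}). blk j)"
    using \<open>i < m\<close> by (intro sum.cong) auto
  also have "\<dots> = blk i + (\<Sum>j\<in>{..<i} \<union> {i<..<m}. blk j)"
    by (intro sum.insert) auto
  also have "(\<Sum>j\<in>{..<i} \<union> {i<..<m}. blk j) = (\<Sum>j<i. blk j) + (\<Sum>j\<in>{i<..<m}. blk j)"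
    by (intro sum.union_disjoint) auto
  finally have "mset_set (blocks f) = blk i + ((\<Sum>j<i. blk j) + (\<Sum>j\<in>{i<..<m}. blk j))"
    using mset_set_blocks[of f, OF f(1)] by (simp add: blk_def)
  then have "mset_set (blocks f) + mset_set (select s (i, B)) = L + I + R"
    unfolding mset_set_select[OF B(1) \<open>i < m\<close> \<open>s \<le> N\<close>] L_def I_def R_def
    by (simp add: blk_def ac_simps)
  moreover have "median (L + I + R) = median I"
  proof (rule median_padding[OF _ _ size])
    show "x \<le> y" if "x \<in># L" "y \<in># I" for x y
      using L[OF that(1)] I[OF that(2)] by simp
    show "x \<le> y" if "x \<in># I" "y \<in># R" for x y
      using I[OF that(1)] R[OF that(2)] by simp
    show "I \<noteq> {#}"
      using ne by (simp add: I_def)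
  qed
  moreover have "median I = offset i + median (mset_set (f i) + mset_set B)"
    unfolding I_def using ne by (rule median_image_add)
  ultimately show ?thesis
    by simp
qed

end

section \<open>Induction over the levels\<close>

text \<open>Without communication the output is constant, but a quarter of the eight singletons
  still contains two, and their medians differ: with \<open>{9}\<close> on the other side, the lower
  middle element is \<open>j\<close>.\<close>

lemma hard_median_0:
  "hard 0 b ((\<lambda>j. {j}) ` {1..8}) {{9::nat}} (\<lambda>A B. median (mset_set A + mset_set B))"
  unfolding hard_def
proof (intro allI impI)
  fix P :: "(nat set, nat set, nat) protocol" and S T and d :: "nat \<Rightarrow> nat"
  assume S: "S \<subseteq> (\<lambda>j. {j}) ` {1..8}" "card ((\<lambda>j. {j}) ` {1..8::nat}) \<le> 4 * card S"
    and T: "T \<subseteq> {{9}}" "card {{9::nat}} \<le> 2 * card T"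
    and bounds: "\<forall>x\<in>S. \<forall>y\<in>T. cost (transcript P x y) \<le> 0 \<and> max_round_bits (transcript P x y) \<le> b"
  have T: "T = {{9}}"
    using T by (cases "T = {}") auto
  have "card ((\<lambda>j. {j}) ` {1..8::nat}) = 8"
    by (simp add: card_image)
  then have "2 \<le> card S"
    using S(2) by simp
  then obtain A A' where A: "A \<in> S" "A' \<in> S" "A \<noteq> A'"
    using card_le_Suc0_iff_eq[of S] card.infinite[of S] by fastforce
  have med: "median (mset_set {j} + mset_set {9}) = j" if "j \<le> 8" for j :: nat
    using that by (simp add: median_def)
  have "A \<in> (\<lambda>j. {j}) ` {1..8}" "A' \<in> (\<lambda>j. {j}) ` {1..8}"
    using A S(1) by blast+
  then obtain j j' where j: "A = {j}" "A' = {j'}" "j \<le> 8" "j' \<le> 8"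
    by auto
  have "cost (transcript P A {9}) = 0"
    using bounds A(1) T by simp
  then have "transcript P A {9} = []"
    by (cases "transcript P A {9}") (auto simp: cost_def num_rounds_def)
  \<comment> \<open>An empty transcript on a single pair already forces the whole tree to be a
    leaf.\<close>
  then obtain z where "P = Output z"
    by (cases P) auto
  then show "\<exists>x\<in>S. \<exists>y\<in>T. d (result P x y) \<noteq> median (mset_set x + mset_set y)"
    using A j med T by (metis insertI1 result.simps(1))
qed

text \<open>The induction carries common sizes because \<open>c\<close> determines the padding of
  the next level; positivity excludes empty sets. The factor \<open>3 * m\<close> stems from
  \<open>m\<close> blocks and two margins, each as wide as all blocks together.\<close>

lemma hard_median:
  assumes m: "m = 4 * (b + 3)"
  shows "\<exists>X Y a c. (\<forall>A\<in>X. A \<subseteq> {1..9 * (3 * m) ^ k} \<and> card A = a) \<and>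
    (\<forall>B\<in>Y. B \<subseteq> {1..9 * (3 * m) ^ k} \<and> card B = c) \<and> 0 < a \<and> 0 < c \<and>
    hard k b X Y (\<lambda>A B. median (mset_set A + mset_set B))"
proof (induction k)
  case 0
  show ?case
    by (rule exI[of _ "(\<lambda>j. {j}) ` {1..8}"], rule exI[of _ "{{9}}"], rule exI[of _ 1], rule exI[of _ 1])
      (use hard_median_0 in auto)
next
  case (Suc k)
  define N where "N = 9 * (3 * m) ^ k"
  obtain X Y a c where X: "\<forall>A\<in>X. A \<subseteq> {1..N} \<and> card A = a" and Y: "\<forall>B\<in>Y. B \<subseteq> {1..N} \<and> card B = c"
    and pos: "0 < a" "0 < c" and hard: "hard k b X Y (\<lambda>A B. median (mset_set A + mset_set B))"
    using Suc.IH[folded N_def] by (elim exE conjE) (rule that, assumption+)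
  have "m > 0"
    using m by simp
  have N: "9 * (3 * m) ^ Suc k = 3 * m * N"
    by (simp add: N_def)
  obtain B0 where "B0 \<in> Y"
    using hard_imp_finite_nonempty(4)[OF hard] by blast
  then have "c \<le> N"
    using Y card_mono[of "{1..N}" B0] by auto
  \<comment> \<open>This undoes the shift in \<open>median_blocks_select\<close>.\<close>
  define h where "h = (\<lambda>i z. z - offset m N i)"
  have mem: "f j \<subseteq> {1..N} \<and> card (f j) = c" if "f \<in> {..<m} \<rightarrow>\<^sub>E Y" "j < m" for f j
    using PiE_mem[OF that(1)] that(2) Y by simp
  \<comment> \<open>The roles swap: tuples of Bob's old sets go to Alice, and Bob gets an index with
    one of Alice's old sets.\<close>
  have "hard (Suc k) b (blocks m N ` ({..<m} \<rightarrow>\<^sub>E Y)) (select m N c ` ({..<m} \<times> X))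
     (\<lambda>A B. median (mset_set A + mset_set B))"
  proof (rule hard_Suc[where F="\<lambda>B A. median (mset_set A + mset_set B)" and h=h])
    show "hard k b X Y (\<lambda>A B. median (mset_set A + mset_set B))"
      by (fact hard)
    show "inj_on (blocks m N) ({..<m} \<rightarrow>\<^sub>E Y)"
      using Y by (intro inj_on_blocks) auto
    show "inj_on (select m N c) ({..<m} \<times> X)"
      using X pos \<open>c \<le> N\<close> by (intro inj_on_select) auto
    fix f i A assume "f \<in> {..<m} \<rightarrow>\<^sub>E Y" "i < m" "A \<in> X"
    then show "h i (median (mset_set (blocks m N f) + mset_set (select m N c (i, A)))) =
        median (mset_set A + mset_set (f i))"
      using mem X pos by (subst median_blocks_select) (auto simp: h_def add.commute)
  qed (fact m)
  moreover have "\<forall>A\<in>blocks m N ` ({..<m} \<rightarrow>\<^sub>E Y). A \<subseteq> {1..3 * m * N} \<and> card A = m * c"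
    using mem by (intro ballI, elim imageE, hypsubst) (intro conjI blocks_subset card_blocks, auto)
  moreover have "\<forall>B\<in>select m N c ` ({..<m} \<times> X). B \<subseteq> {1..3 * m * N} \<and> card B = (m - 1) * c + a"
    using select_subset[OF _ _ \<open>c \<le> N\<close>] card_select[OF _ _ \<open>c \<le> N\<close>] X by auto
  ultimately show ?case
    unfolding N using pos \<open>m > 0\<close>
    by (intro exI[of _ "blocks m N ` ({..<m} \<rightarrow>\<^sub>E Y)"] exI[of _ "select m N c ` ({..<m} \<times> X)"]
        exI[of _ "m * c"] exI[of _ "(m - 1) * c + a"]) simp
qed


section \<open>The trade-off between rounds and message length\<close>

text \<open>Otherwise the hard sets of level \<open>Suc r\<close> would lie within
  \<open>{1..n}\<close>, where \<open>P\<close> is correct. The base of the power is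
  \<open>3 * m\<close> for \<open>m = 4 * (b + 3)\<close>; the extra level covers the surcharge in
  \<open>cost\<close> when Bob opens.\<close>

lemma median_trade_off:
  assumes "solves_median n P"
  shows "n < 9 * (12 * (bits_per_round (Pow {1..n}) (Pow {1..n}) P + 3)) ^
    Suc (round_complexity (Pow {1..n}) (Pow {1..n}) P)"
proof (rule ccontr)
  define r where "r = round_complexity (Pow {1..n}) (Pow {1..n}) P"
  define b where "b = bits_per_round (Pow {1..n}) (Pow {1..n}) P"
  assume "\<not> ?thesis"
  then have n: "9 * (3 * (4 * (b + 3))) ^ Suc r \<le> n"
    by (simp add: r_def b_def)
  obtain X Y a c where X: "\<forall>A\<in>X. A \<subseteq> {1..9 * (3 * (4 * (b + 3))) ^ Suc r} \<and> card A = a"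
    and Y: "\<forall>B\<in>Y. B \<subseteq> {1..9 * (3 * (4 * (b + 3))) ^ Suc r} \<and> card B = c" and "0 < a"
    and hard: "hard (Suc r) b X Y (\<lambda>A B. median (mset_set A + mset_set B))"
    using hard_median[OF refl, of b "Suc r"] by (elim exE conjE) (rule that, assumption+)
  have sub: "A \<subseteq> {1..n}" if "A \<in> X \<or> A \<in> Y" for A
  proof -
    have "A \<subseteq> {1..9 * (3 * (4 * (b + 3))) ^ Suc r}"
      using X Y that by blast
    also have "\<dots> \<subseteq> {1..n}"
      using n by simp
    finally show ?thesis .
  qed
  obtain A B where AB: "A \<in> X" "B \<in> Y" "id (result P A B) \<noteq> median (mset_set A + mset_set B)"
  proof (rule hardD[OF hard, of X Y P id])
    fix A B assume "A \<in> X" "B \<in> Y"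
    then have AB: "(A, B) \<in> Pow {1..n} \<times> Pow {1..n}"
      using sub by blast
    have "num_rounds (transcript P A B) \<le> r"
      unfolding r_def round_complexity_def
      by (rule Max_ge) (use AB in \<open>auto intro!: image_eqI[of _ _ "(A, B)"]\<close>)
    then show "cost (transcript P A B) \<le> Suc r"
      by (simp add: cost_def)
    show "max_round_bits (transcript P A B) \<le> b"
      unfolding b_def bits_per_round_def
      by (rule Max_ge) (use AB in \<open>auto intro!: image_eqI[of _ _ "(A, B)"]\<close>)
  qed auto
  \<comment> \<open>This rules out the pair of empty sets, on which \<open>P\<close> may answer
    arbitrarily.\<close>
  have "A \<noteq> {}"
    using X AB(1) \<open>0 < a\<close> by auto
  then show False
    using assms AB sub by (simp add: solves_median_def)
qed

section \<open>Asymptotics\<close>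

text \<open>\<open>L\<close> stands for the logarithm of \<open>n\<close>. Division by
  \<open>L\<close> leaves a multiple of \<open>L powr (-\<epsilon>)\<close> times a logarithm of a
  linear function of \<open>L\<close>, and a logarithm over \<open>L\<close>; both tend to
  0.\<close>

lemma eventually_trade_off_small:
  fixes \<epsilon> c c' :: real
  assumes "\<epsilon> > 0" "c > 0" "c' > 0"
  shows "eventually (\<lambda>L. 4 + (c * L powr (1 - \<epsilon>) + 1) * log 2 (12 * (c' * L + 3)) \<le> L) at_top"
proof -
  have "((\<lambda>L. L powr (-\<epsilon>) * log 2 (12 * (c' * L + 3))) \<longlongrightarrow> 0) at_top"
    using assms by real_asymp
  moreover have "((\<lambda>L. (4 + log 2 (12 * (c' * L + 3))) / L) \<longlongrightarrow> 0) at_top"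
    using assms by real_asymp
  ultimately have "((\<lambda>L. c * (L powr (-\<epsilon>) * log 2 (12 * (c' * L + 3))) +
      (4 + log 2 (12 * (c' * L + 3))) / L) \<longlongrightarrow> c * 0 + 0) at_top"
    by (intro tendsto_intros)
  then have "eventually (\<lambda>L. c * (L powr (-\<epsilon>) * log 2 (12 * (c' * L + 3))) +
      (4 + log 2 (12 * (c' * L + 3))) / L < 1) at_top"
    by (rule order_tendstoD) simp
  then show ?thesis
    using eventually_gt_at_top[of 0]
  proof eventually_elim
    case (elim L)
    have "4 + (c * L powr (1 - \<epsilon>) + 1) * log 2 (12 * (c' * L + 3)) =
        L * (c * (L powr (-\<epsilon>) * log 2 (12 * (c' * L + 3))) + (4 + log 2 (12 * (c' * L + 3))) / L)"
      using elim(2) by (simp add: powr_diff powr_minus field_simps)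
    also have "\<dots> \<le> L * 1"
      using elim by (intro mult_left_mono) auto
    finally show ?case
      by simp
  qed
qed

theorem theorem2:
  fixes \<epsilon> :: real
  assumes "\<epsilon> > 0"
  shows "\<not> (\<exists>P :: nat \<Rightarrow> (nat set, nat set, nat) protocol.
           (\<forall>n\<ge>1. solves_median n (P n)) \<and>
           (\<lambda>n. real (round_complexity (Pow {1..n}) (Pow {1..n}) (P n)))
              \<in> O(\<lambda>n. log 2 (real n) powr (1 - \<epsilon>)) \<and>
           (\<lambda>n. real (bits_per_round (Pow {1..n}) (Pow {1..n}) (P n)))
              \<in> O(\<lambda>n. log 2 (real n)))"
proof (rule notI, elim exE conjE)
  fix P :: "nat \<Rightarrow> (nat set, nat set, nat) protocol"
  define r where "r = (\<lambda>n. round_complexity (Pow {1..n}) (Pow {1..n}) (P n))"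
  define b where "b = (\<lambda>n. bits_per_round (Pow {1..n}) (Pow {1..n}) (P n))"
  assume solves: "\<forall>n\<ge>1. solves_median n (P n)"
    and "(\<lambda>n. real (round_complexity (Pow {1..n}) (Pow {1..n}) (P n)))
              \<in> O(\<lambda>n. log 2 (real n) powr (1 - \<epsilon>))"
    and "(\<lambda>n. real (bits_per_round (Pow {1..n}) (Pow {1..n}) (P n))) \<in> O(\<lambda>n. log 2 (real n))"
  then have "(\<lambda>n. real (r n)) \<in> O(\<lambda>n. log 2 (real n) powr (1 - \<epsilon>))"
    and "(\<lambda>n. real (b n)) \<in> O(\<lambda>n. log 2 (real n))"
    by (simp_all add: r_def b_def)
  then obtain c c' where c: "c > 0" "\<forall>\<^sub>F n in at_top. norm (real (r n)) \<le> c * norm (log 2 (real n) powr (1 - \<epsilon>))"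
    and c': "c' > 0" "\<forall>\<^sub>F n in at_top. norm (real (b n)) \<le> c' * norm (log 2 (real n))"
    by (elim landau_o.bigE) blast
  have "filterlim (\<lambda>n. log 2 (real n)) at_top sequentially"
    by real_asymp
  then have "\<forall>\<^sub>F n in sequentially. 4 + (c * log 2 (real n) powr (1 - \<epsilon>) + 1) *
      log 2 (12 * (c' * log 2 (real n) + 3)) \<le> log 2 (real n)"
    by (rule eventually_compose_filterlim[OF eventually_trade_off_small[OF assms c(1) c'(1)]])
  \<comment> \<open>All conditions hold eventually, so a single \<open>n\<close> meets them at once;
    for \<open>n \<ge> 1\<close> the logarithm is nonnegative and the norms disappear.\<close>
  then have "\<forall>\<^sub>F n in sequentially. n \<ge> 1 \<and> real (r n) \<le> c * log 2 (real n) powr (1 - \<epsilon>) \<and>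
      real (b n) \<le> c' * log 2 (real n) \<and> 4 + (c * log 2 (real n) powr (1 - \<epsilon>) + 1) *
      log 2 (12 * (c' * log 2 (real n) + 3)) \<le> log 2 (real n)"
    using c(2) c'(2) eventually_ge_at_top[of 1]
    by eventually_elim (auto simp: abs_if split: if_splits)
  then obtain n where n: "n \<ge> 1" "real (r n) \<le> c * log 2 (real n) powr (1 - \<epsilon>)"
      "real (b n) \<le> c' * log 2 (real n)"
    and small: "4 + (c * log 2 (real n) powr (1 - \<epsilon>) + 1) *
      log 2 (12 * (c' * log 2 (real n) + 3)) \<le> log 2 (real n)"
    using eventually_happens' sequentially_bot by blast
  define q where "q = 12 * (real (b n) + 3)"
  have "q \<ge> 1"
    by (simp add: q_def)
  have "real (Suc (r n)) * log 2 q \<le>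
      (c * log 2 (real n) powr (1 - \<epsilon>) + 1) * log 2 (12 * (c' * log 2 (real n) + 3))"
    using n(2,3) \<open>q \<ge> 1\<close> c(1) by (intro mult_mono) (auto simp: q_def)
  then have le: "4 + real (Suc (r n)) * log 2 q \<le> log 2 (real n)"
    using small by linarith
  \<comment> \<open>The summand 4 in the asymptotic bound is there to absorb
    \<open>9 \<le> 2 ^ 4\<close>.\<close>
  have "9 * q ^ Suc (r n) \<le> 2 ^ 4 * q ^ Suc (r n)"
    using \<open>q \<ge> 1\<close> by (intro mult_right_mono) auto
  also have "\<dots> = 2 powr (4 + real (Suc (r n)) * log 2 q)"
    using \<open>q \<ge> 1\<close> by (simp add: powr_add powr_powr[symmetric] powr_realpow mult.commute[of "real _"] del: of_nat_Suc power_Suc)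
  also have "\<dots> \<le> 2 powr log 2 (real n)"
    using le by simp
  also have "\<dots> = real n"
    using n(1) by simp
  finally have "real (9 * (12 * (b n + 3)) ^ Suc (r n)) \<le> real n"
    by (simp add: q_def add.commute)
  then have "9 * (12 * (b n + 3)) ^ Suc (r n) \<le> n"
    by (simp only: of_nat_le_iff)
  moreover have "n < 9 * (12 * (b n + 3)) ^ Suc (r n)"
    unfolding r_def b_def by (rule median_trade_off) (use solves n(1) in blast)
  ultimately show False
    by simp
qed

end
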